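(* Let $\Sigma$ be a combinator (a term built from the constants $\mathbf{K}$ and $\mathbf{S}$ by application, with no variables) such that $\Sigma x \rhd^\star x$ for a variable $x$. Then in the Engeler model $\mathcal{D}$, $[\![\mathbf{I}]\!] \subseteq [\![\Sigma]\!]$, where $[\![\mathbf{I}]\!] = \{(\{t\}\rightarrowtail t) : t \in \mathcal{G}\}$.
   Context: Combinatory logic terms are built from variables $x_0,x_1,\ldots$ and the constants $\mathbf{K},\mathbf{S}$ by application $(X\cdot Y)$, written $XY$, associating to the left. The rewriting rules are $\mathbf{K}xy \rhd x$ and $\mathbf{S}xyz \rhd xz(yz)$ (applied to subterms in the usual way), and $\rhd^\star$ is the reflexive transitive closure of $\rhd$. A combinator is a term with no variables. The Engeler model: write $(a\rightarrowtail b)$ for the ordered pair $(a,b)$. Let $G_0=\{0,1,2,\ldots\}$, $G_{n+1}=G_n\cup\{(\alpha\rightarrowtail b): \alpha\subseteq G_n \text{ finite}, b\in G_n\}$, and $\mathcal{G}=\bigcup_{n\ge 0}G_n$. The model $\mathcal{D}$ has underlying set the power set of $\mathcal{G}$ with the binary operation $M\bullet N=\{s : \text{there is a finite }\alpha\subseteq N \text{ with } (\alpha\rightarrowtail s)\in M\}$. Interpretations: $[\![\mathbf{K}]\!]=\{(\{t\}\rightarrowtail(\emptyset\rightarrowtail t)) : t\in\mathcal{G}\}$; $[\![\mathbf{S}]\!]$ is the set of all elements $\{\tau\rightarrowtail(\{r_1,\ldots,r_n\}\rightarrowtail s)\}\rightarrowtail\big(\{\sigma_1\rightarrowtail r_1,\ldots,\sigma_n\rightarrowtail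 r_n\}\rightarrowtail(\sigma\rightarrowtail s)\big)$ with $n\ge 0$, $r_1,\ldots,r_n,s\in\mathcal{G}$, $\tau,\sigma_1,\ldots,\sigma_n$ finite subsets of $\mathcal{G}$, and $\sigma=\tau\cup\bigcup_i\sigma_i$; and $[\![X\cdot Y]\!]=[\![X]\!]\bullet[\![Y]\!]$. *)

theory Defs
  imports "HOL-Library.FSet"
begin

section \<open>Combinatory logic\<close>

datatype cterm = Var nat | K | S | App cterm cterm (infixl \<open>\<cdot>\<close> 75)

primrec vars :: "cterm \<Rightarrow> nat set" where
  "vars (Var v) = {v}"
| "vars K = {}"
| "vars S = {}"
| "vars (X \<cdot> Y) = vars X \<union> vars Y"

definition combinator :: "cterm \<Rightarrow> bool" where
  "combinator X \<longleftrightarrow> vars X = {}"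

inductive red :: "cterm \<Rightarrow> cterm \<Rightarrow> bool" (infix \<open>\<rhd>\<close> 50) where
  red_K: "K \<cdot> X \<cdot> Y \<rhd> X"
| red_S: "S \<cdot> X \<cdot> Y \<cdot> Z \<rhd> X \<cdot> Z \<cdot> (Y \<cdot> Z)"
| red_left: "X \<rhd> X' \<Longrightarrow> X \<cdot> Y \<rhd> X' \<cdot> Y"
| red_right: "Y \<rhd> Y' \<Longrightarrow> X \<cdot> Y \<rhd> X \<cdot> Y'"

abbreviation reds :: "cterm \<Rightarrow> cterm \<Rightarrow> bool" (infix \<open>\<rhd>\<^sup>*\<close> 50) where
  "reds \<equiv> red\<^sup>*\<^sup>*"


section \<open>The Engeler model\<close>

text \<open>
  The set \<open>\<G>\<close> is rendered as the free type over atoms \<open>0, 1, 2, \<dots>\<close> and arrows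
  \<open>(\<alpha> \<Zinj> b)\<close> with \<open>\<alpha>\<close> finite; arrows are ordered pairs, hence injective, and are
  never atoms. The lemma \<open>Union_G_level\<close> below shows that the cumulative hierarchy
  \<open>G\<^sub>0 \<subseteq> G\<^sub>1 \<subseteq> \<dots>\<close> exhausts this type, so that \<open>\<G>\<close> is its universe.
\<close>

datatype engeler =
    Atom nat
  | Arrow "engeler fset" engeler (infixr \<open>\<Zinj>\<close> 60)

primrec G_level :: "nat \<Rightarrow> engeler set" where
  "G_level 0 = range Atom"
| "G_level (Suc n) = G_level n \<union> {\<alpha> \<Zinj> b | \<alpha> b. fset \<alpha> \<subseteq> G_level n \<and> b \<in> G_level n}"

lemma G_level_mono: "m \<le> n \<Longrightarrow> G_level m \<subseteq> G_level n"
  by (induction n rule: dec_induct) auto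

lemma Union_G_level: "(\<Union>n. G_level n) = UNIV"
proof -
  have "\<exists>n. a \<in> G_level n" for a
  proof (induction a)
    case (Atom k)
    have "Atom k \<in> G_level 0" by simp
    then show ?case ..
  next
    case (Arrow \<alpha> b)
    then obtain m where m: "b \<in> G_level m" by blast
    from Arrow have "\<forall>a\<in>fset \<alpha>. \<exists>n. a \<in> G_level n" by blast
    then obtain f where f: "\<forall>a\<in>fset \<alpha>. a \<in> G_level (f a)" by metis
    define N where "N = Max (insert m (f ` fset \<alpha>))"
    have "m \<le> N" by (simp add: N_def)
    moreover have "f a \<le> N" if "a \<in> fset \<alpha>" for a
      using that by (simp add: N_def)
    ultimately have "b \<in> G_level N" "fset \<alpha> \<subseteq> G_level N"
      using m f G_level_mono by blast+
    then have "\<alpha> \<Zinj> b \<in> G_level (Suc N)" by simp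
    then show ?case ..
  qed
  then show ?thesis by blast
qed

definition eapp :: "engeler set \<Rightarrow> engeler set \<Rightarrow> engeler set" (infixl \<open>\<bullet>\<close> 75) where
  "M \<bullet> N = {s. \<exists>\<alpha>. fset \<alpha> \<subseteq> N \<and> (\<alpha> \<Zinj> s) \<in> M}"

definition eI :: "engeler set" where
  "eI = {{|t|} \<Zinj> t | t. True}"

definition eK :: "engeler set" where
  "eK = {{|t|} \<Zinj> ({||} \<Zinj> t) | t. True}"

text \<open>
  The families \<open>r\<^sub>1, \<dots>, r\<^sub>n\<close> and \<open>\<sigma>\<^sub>1, \<dots>, \<sigma>\<^sub>n\<close> are the values of \<open>r\<close> and \<open>\<sigma>\<close> at the indices
  \<open>0, \<dots>, n - 1\<close>; repetitions among them are allowed.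
\<close>

definition eS :: "engeler set" where
  "eS = {{|\<tau> \<Zinj> (fset_of_list (map r [0..<n]) \<Zinj> s)|} \<Zinj>
           (fset_of_list (map (\<lambda>i. \<sigma> i \<Zinj> r i) [0..<n]) \<Zinj>
             ((\<tau> |\<union>| ffUnion (fset_of_list (map \<sigma> [0..<n]))) \<Zinj> s))
         | n r s \<tau> \<sigma>. True}"

text \<open>
  The assignment \<open>\<rho>\<close> only serves to make the interpretation total on terms with
  variables; it is irrelevant for combinators.
\<close>

primrec interp :: "(nat \<Rightarrow> engeler set) \<Rightarrow> cterm \<Rightarrow> engeler set" where
  "interp \<rho> (Var v) = \<rho> v"
| "interp \<rho> K = eK"
| "interp \<rho> S = eS"
| "interp \<rho> (X \<cdot> Y) = interp \<rho> X \<bullet> interp \<rho> Y"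

lemma interp_combinator: "combinator X \<Longrightarrow> interp \<rho> X = interp \<rho>' X"
  by (induction X) (auto simp: combinator_def)

end

theory Submission
  imports Defs
begin

text \<open>
  The Engeler model satisfies the equations of \<open>K\<close> and \<open>S\<close>, so interpretations are invariant
  under reduction and \<open>interp \<rho> \<Sigma>\<close> acts as the identity on every set. Acting on \<open>{t}\<close>, it must
  contain \<open>\<alpha> \<Zinj> t\<close> for some \<open>\<alpha> \<subseteq> {t}\<close>; since it maps the empty set to itself, \<open>\<alpha>\<close> is not empty.
\<close>

lemma eappI: "fset \<alpha> \<subseteq> N \<Longrightarrow> \<alpha> \<Zinj> s \<in> M \<Longrightarrow> s \<in> M \<bullet> N"
  by (auto simp: eapp_def)

lemma eK_app: "eK \<bullet> M \<bullet> N = M"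
proof
  show "eK \<bullet> M \<bullet> N \<subseteq> M"
    by (auto simp: eapp_def eK_def)
  show "M \<subseteq> eK \<bullet> M \<bullet> N"
  proof
    fix t assume "t \<in> M"
    then have "{||} \<Zinj> t \<in> eK \<bullet> M"
      unfolding eapp_def eK_def by (auto intro!: exI[of _ "{|t|}"])
    \<comment> \<open>The second argument is consumed with the empty support, so this works for
      every \<open>N\<close>, even the empty set.\<close>
    then show "t \<in> eK \<bullet> M \<bullet> N"
      unfolding eapp_def[of "eK \<bullet> M"] by (auto intro!: exI[of _ "{||}"])
  qed
qed

lemma fset_of_list_upt: "fset (fset_of_list (map f [0..<n])) = f ` {..<n}"
  by (simp add: fset_of_list.rep_eq atLeast0LessThan)

lemma fset_arguments:
  "fset (\<tau> |\<union>| ffUnion (fset_of_list (map \<sigma> [0..<n]))) = fset \<tau> \<union> (\<Union>i<n. fset (\<sigma> i))"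
  by (simp add: ffUnion.rep_eq fset_of_list.rep_eq atLeast0LessThan)

text \<open>The last support in an element of \<open>eS\<close> collects \<open>\<tau>\<close> and
  every \<open>\<sigma> i\<close>. Its inclusion in \<open>L\<close> therefore makes each of them
  usable separately: \<open>\<tau>\<close> for applying \<open>M\<close> to \<open>L\<close>, and
  \<open>\<sigma> i\<close> for producing \<open>r i\<close> in
  \<open>N \<bullet> L\<close>.\<close>

lemma eS_app_subset: "eS \<bullet> M \<bullet> N \<bullet> L \<subseteq> M \<bullet> L \<bullet> (N \<bullet> L)"
proof
  fix s assume "s \<in> eS \<bullet> M \<bullet> N \<bullet> L"
  then obtain \<alpha> \<beta> \<gamma> where sub: "fset \<alpha> \<subseteq> M" "fset \<beta> \<subseteq> N" "fset \<gamma> \<subseteq> L"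
    and "\<alpha> \<Zinj> (\<beta> \<Zinj> (\<gamma> \<Zinj> s)) \<in> eS"
    unfolding eapp_def by blast
  then obtain n :: nat and r \<tau> \<sigma> where
    \<alpha>: "\<alpha> = {|\<tau> \<Zinj> (fset_of_list (map r [0..<n]) \<Zinj> s)|}" and
    \<beta>: "\<beta> = fset_of_list (map (\<lambda>i. \<sigma> i \<Zinj> r i) [0..<n])" and
    \<gamma>: "\<gamma> = \<tau> |\<union>| ffUnion (fset_of_list (map \<sigma> [0..<n]))"
    unfolding eS_def by blast
  have \<tau>: "fset \<tau> \<subseteq> L"
    using sub(3) unfolding \<gamma> fset_arguments by blast
  have \<sigma>: "fset (\<sigma> i) \<subseteq> L" if "i < n" for i
    using sub(3) that unfolding \<gamma> fset_arguments by blast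
  have N: "\<sigma> i \<Zinj> r i \<in> N" if "i < n" for i
    using sub(2) that unfolding \<beta> fset_of_list_upt by blast
  have "fset_of_list (map r [0..<n]) \<Zinj> s \<in> M \<bullet> L"
    using eappI[OF \<tau>] sub(1) unfolding \<alpha> by simp
  moreover have "fset (fset_of_list (map r [0..<n])) \<subseteq> N \<bullet> L"
    unfolding fset_of_list_upt using eappI[OF \<sigma> N] by blast
  ultimately show "s \<in> M \<bullet> L \<bullet> (N \<bullet> L)"
    by (rule eappI[rotated])
qed

text \<open>Each of the finitely many elements of \<open>\<delta>\<close> has its own finite support
  in \<open>L\<close>. Joined with \<open>\<tau>\<close>, these supports still form a finite subset
  of \<open>L\<close>, and the element of \<open>eS\<close> built from this data is the required
  witness.\<close>

lemma eS_app_supset: "M \<bullet> L \<bullet> (N \<bullet> L) \<subseteq> eS \<bullet> M \<bullet> N \<bullet> L"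
proof
  fix s assume "s \<in> M \<bullet> L \<bullet> (N \<bullet> L)"
  then obtain \<delta> \<tau> where \<delta>: "fset \<delta> \<subseteq> N \<bullet> L"
    and \<tau>: "fset \<tau> \<subseteq> L" and M: "\<tau> \<Zinj> (\<delta> \<Zinj> s) \<in> M"
    unfolding eapp_def by blast
  \<comment> \<open>Elements of \<open>eS\<close> are indexed by positions below \<open>n\<close>,
    so \<open>\<delta>\<close> is listed and one support is chosen per position.\<close>
  obtain rs where rs: "fset_of_list rs = \<delta>"
    by (rule exists_fset_of_list[THEN exE])
  define n where "n = length rs"
  have "\<forall>i<n. \<exists>\<sigma>. fset \<sigma> \<subseteq> L \<and> \<sigma> \<Zinj> rs ! i \<in> N"
  proof (intro allI impI)
    fix i assume "i < n"
    then have "rs ! i \<in> fset \<delta>"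
      by (simp add: n_def rs[symmetric] fset_of_list.rep_eq)
    then show "\<exists>\<sigma>. fset \<sigma> \<subseteq> L \<and> \<sigma> \<Zinj> rs ! i \<in> N"
      using \<delta> unfolding eapp_def by blast
  qed
  then obtain \<sigma> where \<sigma>: "\<And>i. i < n \<Longrightarrow> fset (\<sigma> i) \<subseteq> L" "\<And>i. i < n \<Longrightarrow> \<sigma> i \<Zinj> rs ! i \<in> N"
    by metis
  define \<beta> where "\<beta> = fset_of_list (map (\<lambda>i. \<sigma> i \<Zinj> rs ! i) [0..<n])"
  define \<gamma> where "\<gamma> = \<tau> |\<union>| ffUnion (fset_of_list (map \<sigma> [0..<n]))"
  \<comment> \<open>This puts \<open>\<delta>\<close> into the shape required by \<open>eS\<close>,
    with \<open>(!) rs\<close> as the family \<open>r\<close>.\<close>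
  have "\<delta> = fset_of_list (map ((!) rs) [0..<n])"
    by (simp add: n_def map_nth rs)
  then have S: "{|\<tau> \<Zinj> (\<delta> \<Zinj> s)|} \<Zinj> (\<beta> \<Zinj> (\<gamma> \<Zinj> s)) \<in> eS"
    unfolding eS_def \<beta>_def \<gamma>_def by blast
  have \<alpha>: "fset {|\<tau> \<Zinj> (\<delta> \<Zinj> s)|} \<subseteq> M"
    using M by simp
  have \<beta>: "fset \<beta> \<subseteq> N"
    using \<sigma>(2) unfolding \<beta>_def fset_of_list_upt by blast
  have \<gamma>: "fset \<gamma> \<subseteq> L"
    using \<tau> \<sigma>(1) unfolding \<gamma>_def fset_arguments by blast
  show "s \<in> eS \<bullet> M \<bullet> N \<bullet> L"
    by (rule eappI[OF \<gamma> eappI[OF \<beta> eappI[OF \<alpha> S]]])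
qed

lemma eS_app: "eS \<bullet> M \<bullet> N \<bullet> L = M \<bullet> L \<bullet> (N \<bullet> L)"
  using eS_app_subset eS_app_supset by blast

text \<open>The rules for \<open>K\<close> and \<open>S\<close> hold as equations between arbitrary
  sets, and \<open>interp\<close> is compositional, so contraction inside a subterm is mere
  congruence.\<close>

lemma interp_red: "X \<rhd> Y \<Longrightarrow> interp \<rho> X = interp \<rho> Y"
  by (induction rule: red.induct) (simp_all add: eK_app eS_app)

lemma interp_reds: "X \<rhd>\<^sup>* Y \<Longrightarrow> interp \<rho> X = interp \<rho> Y"
  by (induction rule: rtranclp_induct) (auto dest: interp_red)

theorem theorem4:
  fixes \<Sigma> :: cterm and x :: nat and \<rho> :: "nat \<Rightarrow> engeler set"
  assumes "combinator \<Sigma>"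
    and "\<Sigma> \<cdot> Var x \<rhd>\<^sup>* Var x"
  shows "eI \<subseteq> interp \<rho> \<Sigma>"
proof -
  \<comment> \<open>The constant assignment puts \<open>M\<close> in place of the variable and
    leaves the value of the closed term \<open>\<Sigma>\<close> unchanged. Both inclusions in this
    equation matter: one at \<open>{t}\<close>, the other at \<open>{}\<close>.\<close>
  have id: "interp \<rho> \<Sigma> \<bullet> M = M" for M
    using interp_reds[OF assms(2), of "\<lambda>_. M"] interp_combinator[OF assms(1), of \<rho> "\<lambda>_. M"]
    by simp
  have "{|t|} \<Zinj> t \<in> interp \<rho> \<Sigma>" for t
  proof -
    have "t \<in> interp \<rho> \<Sigma> \<bullet> {t}"
      by (simp add: id)
    then obtain \<alpha> where \<alpha>: "fset \<alpha> \<subseteq> {t}" "\<alpha> \<Zinj> t \<in> interp \<rho> \<Sigma>"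
      unfolding eapp_def by blast
    have "\<alpha> \<noteq> {||}"
      using \<alpha>(2) id[of "{}"] by (auto simp: eapp_def)
    with \<alpha>(1) have "\<alpha> = {|t|}"
      by auto
    with \<alpha>(2) show ?thesis
      by simp
  qed
  then show ?thesis
    by (auto simp: eI_def)
qed

end
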